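(* Let $n\ge 2$ and let $S$ be a set of $n$ points in $\mathbb{R}^2$. Then the number of unordered pairs $\{p,q\}\subset S$ with $|p-q|=1$ and such that $\{p,q\}$ has rational angle is at most $n^{1+6/\sqrt{\log n}}$, where $\log$ denotes the natural logarithm.
   Context: Identify $\mathbb{R}^2$ with $\mathbb{C}$. A pair of distinct points $p,q$ has rational angle if the segment between them, viewed as the complex number $q-p=re^{\pi i\gamma}$ with $r>0$, has $\gamma\in\mathbb{Q}$; equivalently, the line through $p$ and $q$ makes an angle with the $x$-axis that is a rational multiple of $\pi$. *)

theory Defs
  imports "HOL-Analysis.Analysis"
begin

definition rational_angle :: "complex \<Rightarrow> complex \<Rightarrow> bool" where
  "rational_angle p q \<longleftrightarrow> p \<noteq> q \<and>
     (\<exists>r::real. \<exists>\<gamma>::real. r > 0 \<and> \<gamma> \<in> \<rat> \<and>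
        q - p = complex_of_real r * exp (complex_of_real (pi * \<gamma>) * \<i>))"

definition unit_rational_pairs :: "complex set \<Rightarrow> complex set set" where
  "unit_rational_pairs S =
     {{p, q} | p q. p \<in> S \<and> q \<in> S \<and> cmod (p - q) = 1 \<and> rational_angle p q}"

end

theory Submission
  imports Defs
begin

text \<open>
  Unit steps of rational angle are roots of unity. If there were more than
  \<open>n exp (6 \<surd>(ln n))\<close> such pairs, some nonempty subset would have all degrees at least
  \<open>d \<approx> exp (6 \<surd>(ln n)) / 2\<close>. From a fixed vertex, walk \<open>k \<approx> \<surd>(ln n) / 2\<close> steps, never letting a
  nonempty subsum of the steps vanish; each step excludes at most \<open>2 ^ k\<close> of the \<open>d\<close> choices, so
  there are at least \<open>(d - 2 ^ k) ^ k\<close> walks. Two walks with the same endpoints give a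
  vanishing sum of \<open>2 k\<close> roots of unity in which every minimal vanishing subsum uses steps of
  both walks. By Mann's theorem the ratios inside a minimal vanishing sum of length \<open>l\<close> have order
  dividing the product of the primes up to \<open>l\<close>, which is at most \<open>4 ^ l\<close>. Hence at
  most \<open>(k 16 ^ k) ^ k\<close> walks share an endpoint, so there are at most \<open>n (k 16 ^ k) ^ k\<close> walks,
  which is too few.
\<close>

section \<open>Conjugation of vanishing sums of roots of unity\<close>

text \<open>Elements of Z[z] are handled as values of integer polynomials at \<open>z\<close>; a
  congruence modulo q in Z[z] becomes an equality up to a term
  \<open>of_nat q * eval_int z r\<close>.\<close>

definition eval_int :: "complex \<Rightarrow> int poly \<Rightarrow> complex" where
  "eval_int z f = poly (map_poly of_int f) z"

lemma eval_int_0 [simp]: "eval_int z 0 = 0"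
  and eval_int_1 [simp]: "eval_int z 1 = 1"
  and eval_int_pCons [simp]: "eval_int z (pCons a f) = of_int a + z * eval_int z f"
  by (simp_all add: eval_int_def map_poly_pCons)

lemma eval_int_add [simp]: "eval_int z (f + g) = eval_int z f + eval_int z g"
proof -
  have "map_poly of_int (f + g) = (map_poly of_int f + map_poly of_int g :: complex poly)"
    by (rule poly_eqI) (simp add: coeff_map_poly)
  then show ?thesis by (simp add: eval_int_def)
qed

lemma eval_int_mult [simp]: "eval_int z (f * g) = eval_int z f * eval_int z g"
proof -
  have "map_poly of_int (f * g) = (map_poly of_int f * map_poly of_int g :: complex poly)"
    by (rule poly_eqI) (simp add: coeff_map_poly coeff_mult)
  then show ?thesis by (simp add: eval_int_def)
qed

lemma eval_int_smult [simp]: "eval_int z (smult a f) = of_int a * eval_int z f"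
  using eval_int_mult[of z "[:a:]" f] by simp

lemma eval_int_minus [simp]: "eval_int z (- f) = - eval_int z f"
  using eval_int_smult[of z "-1" f] by simp

lemma eval_int_diff [simp]: "eval_int z (f - g) = eval_int z f - eval_int z g"
  using eval_int_add[of z f "- g"] by simp

lemma eval_int_power [simp]: "eval_int z (f ^ n) = eval_int z f ^ n"
  by (induction n) auto

lemma eval_int_monom [simp]: "eval_int z (monom a n) = of_int a * z ^ n"
  by (induction n) (auto simp: monom_0 monom_Suc)

lemma eval_int_sum [simp]: "eval_int z (sum f A) = (\<Sum>i\<in>A. eval_int z (f i))"
  by (induction A rule: infinite_finite_induct) auto

section \<open>Congruences modulo a prime in Z[z]\<close>

text \<open>The inner binomial coefficients are divisible by \<open>q\<close>. The general ring
  serves both integers and integer polynomials.\<close>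

lemma add_power_prime:
  fixes a b :: "'a :: comm_ring_1"
  assumes "prime q"
  shows "\<exists>c. (a + b) ^ q = a ^ q + b ^ q + of_nat q * c"
proof -
  have q0: "q > 0" "q \<noteq> 0" using assms prime_gt_0_nat by auto
  define c where "c = (\<Sum>k\<in>{1..<q}. of_nat ((q choose k) div q) * a ^ k * b ^ (q - k))"
  have "(a + b) ^ q = (\<Sum>k\<le>q. of_nat (q choose k) * a ^ k * b ^ (q - k))"
    by (rule binomial_ring)
  also have "{..q} = insert 0 (insert q {1..<q})" using q0 by auto
  also have "(\<Sum>k\<in>insert 0 (insert q {1..<q}). of_nat (q choose k) * a ^ k * b ^ (q - k)) =
      b ^ q + (a ^ q + (\<Sum>k\<in>{1..<q}. of_nat (q choose k) * a ^ k * b ^ (q - k)))"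
    using q0 by simp
  also have "(\<Sum>k\<in>{1..<q}. of_nat (q choose k) * a ^ k * b ^ (q - k)) = of_nat q * c"
    unfolding c_def sum_distrib_left
  proof (rule sum.cong[OF refl])
    fix k assume "k \<in> {1..<q}"
    then have "q dvd (q choose k)" using assms by (intro dvd_choose_prime) auto
    then have "of_nat (q choose k) = (of_nat q * of_nat ((q choose k) div q) :: 'a)"
      by (metis dvd_mult_div_cancel of_nat_mult)
    then show "of_nat (q choose k) * a ^ k * b ^ (q - k) =
        of_nat q * (of_nat ((q choose k) div q) * a ^ k * b ^ (q - k))"
      by (simp add: mult.assoc)
  qed
  finally show ?thesis by (intro exI[of _ c]) simp
qed

lemma eval_int_of_nat [simp]: "eval_int z (of_nat n) = of_nat n"
  by (induction n) auto

lemma fermat_int: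
  fixes a :: int
  assumes "prime q"
  shows "int q dvd a - a ^ q"
proof (induction a rule: int_induct[of _ 0])
  case base
  show ?case using assms prime_gt_0_nat by (simp add: zero_power)
next
  case (step1 i)
  obtain c where "(i + 1) ^ q = i ^ q + 1 ^ q + of_nat q * c"
    using add_power_prime[OF assms] by blast
  then have "(i + 1) - (i + 1) ^ q = (i - i ^ q) - int q * c" by simp
  then show ?case using step1 by (metis dvd_diff dvd_triv_left)
next
  case (step2 i)
  obtain c where "((i - 1) + 1) ^ q = (i - 1) ^ q + 1 ^ q + of_nat q * c"
    using add_power_prime[OF assms] by blast
  then have "(i - 1) - (i - 1) ^ q = (i - i ^ q) + int q * c" by simp
  then show ?case using step2 by (metis dvd_add dvd_triv_left)
qed

text \<open>Taking q-th powers is additive modulo q, and a ^ q is congruent to a for every integer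
  coefficient a, so induction along Horner's scheme applies.\<close>

lemma eval_int_frobenius:
  assumes "prime q"
  shows "\<exists>r. eval_int (z ^ q) f = eval_int z f ^ q + of_nat q * eval_int z r"
proof (induction f)
  case 0
  have "q > 0" using assms prime_gt_0_nat by auto
  then show ?case by (intro exI[of _ 0]) simp
next
  case (pCons a f)
  then obtain r where r: "eval_int (z ^ q) f = eval_int z f ^ q + of_nat q * eval_int z r"
    by blast
  \<comment> \<open>The expansion is made in Z[X] rather than in the complex numbers, so that the
    error term has its value in Z[z].\<close>
  obtain c where c: "([:a:] + pCons 0 f) ^ q = [:a:] ^ q + pCons 0 f ^ q + of_nat q * c"
    using add_power_prime[OF assms] by blast
  obtain b where b: "a - a ^ q = int q * b" using fermat_int[OF assms] by blast
  have b': "of_int a - of_int a ^ q = (of_nat q * of_int b :: complex)"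
    using arg_cong[OF b, of of_int] by simp
  have "eval_int z (([:a:] + pCons 0 f) ^ q) =
      of_int a ^ q + (z * eval_int z f) ^ q + of_nat q * eval_int z c"
    unfolding c by simp
  then have "eval_int z (pCons a f) ^ q =
      of_int a ^ q + (z * eval_int z f) ^ q + of_nat q * eval_int z c"
    by simp
  moreover have "eval_int (z ^ q) (pCons a f) =
      of_int a + z ^ q * (eval_int z f ^ q + of_nat q * eval_int z r)"
    using r by simp
  ultimately have "eval_int (z ^ q) (pCons a f) = eval_int z (pCons a f) ^ q
      + of_nat q * eval_int z ([:b:] + monom 1 q * r - c)"
    using b' by (simp add: algebra_simps power_mult_distrib)
  then show ?case by blast
qed

section \<open>Integer minimal polynomials of roots of unity\<close>

text \<open>An annihilating polynomial of least degree is made primitive. By pseudo-division it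
  divides an integer multiple of any annihilating \<open>f\<close>, and Gauss's lemma removes the
  multiplier.\<close>

lemma integer_minimal_polynomial:
  assumes "f0 \<noteq> 0" "eval_int z f0 = 0"
  obtains g where "g \<noteq> 0" "eval_int z g = 0" "\<And>f. eval_int z f = 0 \<Longrightarrow> g dvd f"
proof -
  obtain g0 where g0: "g0 \<noteq> 0" "eval_int z g0 = 0"
    and least: "\<And>f. f \<noteq> 0 \<Longrightarrow> eval_int z f = 0 \<Longrightarrow> degree g0 \<le> degree f"
    using ex_has_least_nat[of "\<lambda>f. f \<noteq> 0 \<and> eval_int z f = 0" f0 degree] assms by blast
  define g where "g = primitive_part g0"
  have "eval_int z (smult (content g0) g) = 0"
    using g0 by (simp add: g_def del: eval_int_smult)
  then have root: "eval_int z g = 0" using g0 by simp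
  have "g \<noteq> 0" using g0 by (simp add: g_def)
  moreover have "g dvd f" if f: "eval_int z f = 0" for f
  proof -
    obtain a u where a: "a \<noteq> 0" and eq: "smult a f = g * u + pseudo_mod f g"
      using pseudo_mod(1)[OF \<open>g \<noteq> 0\<close>, of f] by blast
    have "eval_int z (pseudo_mod f g) = 0"
      using arg_cong[OF eq, of "eval_int z"] f root by simp
    moreover have "pseudo_mod f g = 0 \<or> degree (pseudo_mod f g) < degree g0"
      using pseudo_mod(2)[OF \<open>g \<noteq> 0\<close>, of f] by (simp add: g_def)
    ultimately have "pseudo_mod f g = 0" using least by fastforce
    then have "g dvd smult a f" using eq by simp
    then have "primitive_part g dvd primitive_part (smult a f)"
      using a by (cases "f = 0") (auto intro!: primitive_part_dvd_primitive_partI)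
    moreover have "primitive_part g = g"
      using g0 by (simp add: g_def primitive_part_prim)
    moreover have "primitive_part (smult a f) dvd primitive_part f"
      using a by (auto simp: primitive_part_smult sgn_if)
    moreover have "primitive_part f dvd f"
      by (metis content_times_primitive_part dvd_refl dvd_smult)
    ultimately show "g dvd f" by (metis dvd_trans)
  qed
  ultimately show thesis using root that by blast
qed

lemma degree_monom_minus_1:
  assumes "N > 0"
  shows "degree (monom 1 N - 1 :: int poly) = N"
  using degree_add_eq_left[of "-1 :: int poly" "monom 1 N"] assms by (simp add: degree_monom_eq)

lemma root_of_unity_minimal_polynomial:
  assumes "z ^ N = 1" "N > 0"
  obtains g where "g dvd monom 1 N - 1" "eval_int z g = 0" "\<And>f. eval_int z f = 0 \<Longrightarrow> g dvd f"
proof -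
  have "monom 1 N - 1 \<noteq> (0 :: int poly)"
    using degree_monom_minus_1[OF assms(2)] assms(2) by auto
  moreover have root: "eval_int z (monom 1 N - 1) = 0" using assms by simp
  ultimately obtain g where "eval_int z g = 0" "\<And>f. eval_int z f = 0 \<Longrightarrow> g dvd f"
    using integer_minimal_polynomial by metis
  then show thesis using root that by blast
qed

text \<open>The minimal polynomial \<open>g\<close> divides the monic X ^ N - 1, so its leading
  coefficient is a unit and \<open>s\<close> can be reduced modulo \<open>g\<close> to some
  \<open>r\<close>. As \<open>q r - a e\<close> vanishes at \<open>z\<close> and has degree below
  that of \<open>g\<close>, it is zero, and constant terms can be compared.\<close>

lemma eval_int_integral:
  assumes z: "z ^ N = 1" "N > 0" and eq: "of_int e = of_nat q * eval_int z s"
  shows "int q dvd e"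
proof -
  obtain g where g_dvd: "g dvd monom 1 N - 1" and g0: "eval_int z g = 0"
    and min: "\<And>f. eval_int z f = 0 \<Longrightarrow> g dvd f"
    using root_of_unity_minimal_polynomial[OF z] by blast
  have "monom 1 N - 1 \<noteq> (0 :: int poly)"
    using degree_monom_minus_1[OF z(2)] z(2) by auto
  then have g: "g \<noteq> 0" "eval_int z g = 0" using g_dvd g0 by auto
  obtain k where k: "monom 1 N - 1 = g * k" using g_dvd by blast
  have "lead_coeff g dvd lead_coeff (monom 1 N - 1 :: int poly)"
    unfolding k lead_coeff_mult by simp
  also have "lead_coeff (monom 1 N - 1 :: int poly) = 1"
    using z by (simp add: degree_monom_minus_1)
  finally have unit: "is_unit (lead_coeff g)" .
  have dg: "degree g > 0"
    using g by (metis degree_eq_zeroE eval_int_pCons eval_int_0 mult_zero_right add.right_neutral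
        of_int_eq_0_iff pCons_0_0 gr0I)
  obtain u r where ur: "pseudo_divmod s g = (u, r)" by fastforce
  define a where "a = lead_coeff g ^ (Suc (degree s) - degree g)"
  have sa: "smult a s = g * u + r" and dr: "r = 0 \<or> degree r < degree g"
    using pseudo_divmod[OF g(1) ur] by (simp_all add: a_def)
  have ua: "is_unit a" using unit unfolding a_def by (metis is_unit_power_iff)
  have "eval_int z r = of_int a * eval_int z s"
    using arg_cong[OF sa, of "eval_int z"] g by simp
  then have "eval_int z (smult (int q) r - [:a * e:]) = 0"
    using eq by simp
  then have "g dvd smult (int q) r - [:a * e:]" by (rule min)
  moreover have "degree (smult (int q) r - [:a * e:]) < degree g"
    using dr dg by (intro degree_diff_less) (auto simp: degree_smult_eq)
  ultimately have "smult (int q) r - [:a * e:] = 0"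
    using dvd_imp_degree_le by fastforce
  then have "coeff (smult (int q) r - [:a * e:]) 0 = 0" by simp
  then have "int q dvd a * e" by (simp add: dvd_def) (metis mult.commute)
  then show ?thesis using ua by (metis dvd_mult_unit_iff')
qed

text \<open>
  Write \<open>X ^ N - 1 = g h\<close> with \<open>g\<close> the minimal polynomial of \<open>z\<close>. If \<open>g\<close> did not vanish at \<open>z ^ q\<close>,
  then \<open>h\<close> would, and differentiating would give \<open>N z ^ (q (N - 1)) = g (z ^ q) h' (z ^ q)\<close>. This is
  divisible by \<open>q\<close> because \<open>g (z ^ q)\<close> is congruent to \<open>g (z) ^ q = 0\<close> modulo \<open>q\<close>.
\<close>

lemma eval_int_prime_power:
  assumes z: "z ^ N = 1" "N > 0" and q: "prime q" "\<not> q dvd N" and f: "eval_int z f = 0"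
  shows "eval_int (z ^ q) f = 0"
proof -
  have zq: "(z ^ q) ^ N = 1" using z by (metis power_mult mult.commute power_one)
  obtain g where g_dvd: "g dvd monom 1 N - 1" and g: "eval_int z g = 0"
    and min: "\<And>f. eval_int z f = 0 \<Longrightarrow> g dvd f"
    using root_of_unity_minimal_polynomial[OF z] by blast
  have "eval_int (z ^ q) g = 0"
  proof (rule ccontr)
    assume neq: "eval_int (z ^ q) g \<noteq> 0"
    obtain h where h: "monom 1 N - 1 = g * h" using g_dvd by blast
    have "eval_int (z ^ q) (g * h) = 0" using zq by (simp flip: h)
    then have h0: "eval_int (z ^ q) h = 0" using neq by simp
    obtain r where r: "eval_int (z ^ q) g = of_nat q * eval_int z r"
      using eval_int_frobenius[OF q(1), of z g] g prime_gt_0_nat[OF q(1)]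
      by (auto simp: zero_power)
    obtain t where t: "eval_int (z ^ q) (pderiv h) = eval_int z (pderiv h ^ q + of_nat q * t)"
      using eval_int_frobenius[OF q(1), of z "pderiv h"] by auto
    have "pderiv (monom 1 N - 1) = g * pderiv h + h * pderiv g"
      unfolding h by (rule pderiv_mult)
    then have "monom (int N) (N - 1) = g * pderiv h + h * pderiv g"
      by (simp add: pderiv_diff pderiv_monom)
    from arg_cong[OF this, of "eval_int (z ^ q)"]
    have "of_nat N * (z ^ q) ^ (N - 1) = of_nat q * eval_int z (r * (pderiv h ^ q + of_nat q * t))"
      using h0 r t by simp
    moreover have "(z ^ q) ^ (N - 1) * z ^ q = 1"
      using zq z(2) by (metis power_minus_mult)
    ultimately have "of_nat N = of_nat q * eval_int z (r * (pderiv h ^ q + of_nat q * t)) * z ^ q"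
      by (metis mult.assoc mult.right_neutral)
    then have "of_int (int N) = of_nat q * eval_int z (r * (pderiv h ^ q + of_nat q * t) * monom 1 q)"
      by simp
    then have "int q dvd int N" using eval_int_integral[OF z] by blast
    then show False using q by simp
  qed
  then show ?thesis using min[OF f] by auto
qed

text \<open>Prime factors of \<open>j\<close> are peeled off one at a time; \<open>z\<close> varies
  in the induction because \<open>z ^ q\<close> takes its place.\<close>

lemma eval_int_coprime_power:
  assumes "z ^ N = 1" "N > 0" "coprime j N" "j > 0" "eval_int z f = 0"
  shows "eval_int (z ^ j) f = 0"
  using assms
proof (induction j arbitrary: z rule: less_induct)
  case (less j)
  show ?case
  proof (cases "j = 1")
    case False
    then obtain q where q: "prime q" "q dvd j" using prime_factor_nat by blast
    then obtain i where i: "j = q * i" by blast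
    have "\<not> q dvd N"
      using q less.prems(3) by (metis coprime_common_divisor_nat not_prime_1)
    then have "eval_int (z ^ q) f = 0"
      using eval_int_prime_power less.prems q by blast
    moreover have "i < j" "i > 0" "coprime i N"
      using i less.prems q prime_gt_1_nat by auto
    moreover have "(z ^ q) ^ N = 1" using less.prems by (metis power_mult mult.commute power_one)
    ultimately have "eval_int ((z ^ q) ^ i) f = 0" using less.IH less.prems by blast
    then show ?thesis by (simp add: i power_mult)
  qed (use less.prems in simp)
qed

text \<open>This stands in for the Galois automorphism raising N-th roots of unity to the power
  \<open>j\<close>: once every \<open>w i\<close> is a power of one primitive root, the sum is the
  value of an integer polynomial.\<close>

lemma sum_roots_of_unity_conjugate:
  fixes w :: "'a \<Rightarrow> complex"
  assumes w: "\<And>i. i \<in> B \<Longrightarrow> w i ^ N = 1" and N: "N > 0" and j: "coprime j N" "j > 0"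
    and "(\<Sum>i\<in>B. w i) = 0"
  shows "(\<Sum>i\<in>B. w i ^ j) = 0"
proof -
  define z where "z = cis (2 * pi / N)"
  have zN: "z ^ N = 1" using N unfolding z_def Complex.DeMoivre by simp
  have "\<exists>e. w i = z ^ e" if "i \<in> B" for i
  proof -
    have "w i \<in> (\<lambda>k. cis (2 * pi * real k / real N)) ` {..<N}"
      using Complex.bij_betw_roots_unity[OF N] w[OF that] by (auto simp: bij_betw_def)
    then obtain k where "w i = cis (2 * pi * real k / real N)" by blast
    then have "w i = z ^ k" by (simp add: z_def Complex.DeMoivre mult_ac)
    then show ?thesis by blast
  qed
  then obtain e where e: "\<And>i. i \<in> B \<Longrightarrow> w i = z ^ e i" by metis
  define f where "f = (\<Sum>i\<in>B. monom 1 (e i) :: int poly)"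
  have "eval_int z f = 0" using assms(5) e by (simp add: f_def)
  then have "eval_int (z ^ j) f = 0"
    using eval_int_coprime_power zN N j by blast
  then show ?thesis using e by (simp add: f_def mult.commute flip: power_mult)
qed

section \<open>Mann's theorem\<close>

lemma sum_powers_root_of_unity:
  fixes x :: complex
  assumes "x ^ p = 1"
  shows "(\<Sum>t<p. x ^ t) = (if x = 1 then of_nat p else 0)"
  using assms by (simp add: geometric_sum)

text \<open>Fourier inversion: the mean over t < p of (w ^ M / c) ^ t is 1 on the class w ^ M = c
  and 0 off it.\<close>

lemma root_of_unity_class_sum:
  fixes w :: "'a \<Rightarrow> complex"
  assumes "finite B" and w: "\<And>i. i \<in> B \<Longrightarrow> w i ^ (p * M) = 1" and c: "c ^ p = 1" "p > 0"
  shows "of_nat p * sum w {i \<in> B. w i ^ M = c} =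
    (\<Sum>t<p. inverse c ^ t * (\<Sum>i\<in>B. w i ^ (1 + t * M)))"
proof -
  have c0: "c \<noteq> 0" using c by (auto simp: zero_power)
  have "(\<Sum>t<p. inverse c ^ t * (\<Sum>i\<in>B. w i ^ (1 + t * M))) =
      (\<Sum>t<p. \<Sum>i\<in>B. w i * (w i ^ M / c) ^ t)"
    by (simp add: sum_distrib_left divide_inverse power_mult_distrib mult_ac flip: power_mult)
  also have "\<dots> = (\<Sum>i\<in>B. w i * (\<Sum>t<p. (w i ^ M / c) ^ t))"
    by (subst sum.swap) (simp add: sum_distrib_left)
  also have "\<dots> = (\<Sum>i\<in>B. if w i ^ M = c then of_nat p * w i else 0)"
  proof (rule sum.cong[OF refl])
    fix i assume "i \<in> B"
    then have "(w i ^ M / c) ^ p = 1"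
      using w c by (simp add: power_divide mult.commute flip: power_mult)
    then show "w i * (\<Sum>t<p. (w i ^ M / c) ^ t) = (if w i ^ M = c then of_nat p * w i else 0)"
      using c0 by (simp add: sum_powers_root_of_unity)
  qed
  also have "\<dots> = of_nat p * sum w {i \<in> B. w i ^ M = c}"
    using assms(1) by (simp add: sum.inter_filter sum_distrib_left) (auto intro!: sum.cong)
  finally show ?thesis by simp
qed

text \<open>
  The conjugations \<open>w \<mapsto> w ^ (1 + t M)\<close> multiply the class \<open>w ^ M = c\<close> by \<open>c ^ t\<close>, and all of them
  (if \<open>p dvd M\<close>) or all but one preserve the relation. Fourier inversion over \<open>t\<close> then
  shows that every class sum vanishes, or that no class sum does and all \<open>p\<close> classes are
  inhabited.
\<close>

lemma minimal_vanishing_sum_prime: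
  fixes w :: "'a \<Rightarrow> complex"
  assumes B: "finite B" and w: "\<And>i. i \<in> B \<Longrightarrow> w i ^ (p * M) = 1" and p: "prime p" and M: "M > 0"
    and sum0: "sum w B = 0" and min: "\<And>A. A \<subset> B \<Longrightarrow> A \<noteq> {} \<Longrightarrow> sum w A \<noteq> 0"
    and j: "j \<in> B" "w j = 1" and i: "i \<in> B" "w i ^ M \<noteq> 1"
  shows "\<not> p dvd M \<and> p \<le> card B"
proof -
  define G where "G t = (\<Sum>i\<in>B. w i ^ (1 + t * M))" for t
  define F where "F c = sum w {i \<in> B. w i ^ M = c}" for c
  have p0: "p > 0" using p prime_gt_0_nat by auto
  have F: "of_nat p * F c = (\<Sum>t<p. inverse c ^ t * G t)" if "c ^ p = 1" for c
    unfolding F_def G_def using root_of_unity_class_sum[OF B w that p0] .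
  \<comment> \<open>The class of 1 contains \<open>j\<close> and misses \<open>i\<close>, so
    minimality applies.\<close>
  have F1: "F 1 \<noteq> 0" unfolding F_def using i j by (intro min) auto
  have coprime_M: "coprime (1 + t * M) M" for t
    by (metis coprime_1_left coprime_mult_self_left_iff gcd_add_mult coprime_iff_gcd_eq_1 add.commute
        gcd.commute gcd_1_nat mult.commute One_nat_def)
  have G0: "G t = 0" if "\<not> p dvd 1 + t * M" for t
  proof -
    have "coprime (1 + t * M) (p * M)"
      using coprime_M that p by (simp add: prime_imp_coprime coprime_commute)
    then show ?thesis
      unfolding G_def using sum_roots_of_unity_conjugate[of B w "p * M" "1 + t * M"] w p0 M sum0
      by auto
  qed
  have "\<not> p dvd M"
  proof
    assume "p dvd M"
    then have "\<not> p dvd 1 + t * M" for t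
      using p by (metis dvd_add_left_iff dvd_mult not_prime_unit)
    then have "of_nat p * F 1 = 0" using F[of 1] G0 by simp
    then show False using F1 p0 by simp
  qed
  moreover have "p \<le> card B"
  proof -
    \<comment> \<open>Since M is invertible modulo p, at most one t < p makes 1 + t M divisible by
      p; all other conjugations preserve the relation.\<close>
    have "\<exists>t0<p. \<forall>t<p. t \<noteq> t0 \<longrightarrow> \<not> p dvd 1 + t * M"
    proof (rule ccontr)
      assume neg: "\<not> ?thesis"
      then obtain t where t: "t < p" "p dvd 1 + t * M" using p0 by blast
      then obtain u where u: "u < p" "u \<noteq> t" "p dvd 1 + u * M" using neg by blast
      have "int p dvd int (1 + t * M) - int (1 + u * M)"
        using t u by (meson dvd_diff of_nat_dvd_iff)
      then have "int p dvd (int t - int u) * int M" by (simp add: algebra_simps)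
      then have "int p dvd int t - int u"
        using p \<open>\<not> p dvd M\<close> by (simp add: prime_dvd_mult_iff)
      then show False using t u zdvd_imp_le[of "int p" "\<bar>int t - int u\<bar>"] by auto
    qed
    then obtain t0 where t0: "t0 < p" "\<And>t. t < p \<Longrightarrow> t \<noteq> t0 \<Longrightarrow> G t = 0" using G0 by blast
    \<comment> \<open>With only the term \<open>t0\<close> left, each class sum is a nonzero
      multiple of \<open>G t0\<close>, and \<open>F 1\<close> shows that \<open>G t0\<close> is
      nonzero.\<close>
    have F': "of_nat p * F c = inverse c ^ t0 * G t0" if "c ^ p = 1" for c
    proof -
      have "(\<Sum>t<p. inverse c ^ t * G t) = (\<Sum>t\<in>{t0}. inverse c ^ t * G t)"
        using t0 by (intro sum.mono_neutral_right) auto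
      then show ?thesis using F[OF that] by simp
    qed
    have "G t0 \<noteq> 0" using F'[of 1] F1 p0 by auto
    have "{c. c ^ p = 1} \<subseteq> (\<lambda>i. w i ^ M) ` B"
    proof
      fix c :: complex assume "c \<in> {c. c ^ p = 1}"
      then have c: "c ^ p = 1" by simp
      then have "c \<noteq> 0" using p0 by (auto simp: zero_power)
      then have "F c \<noteq> 0" using F'[OF c] \<open>G t0 \<noteq> 0\<close> by auto
      then have "{i \<in> B. w i ^ M = c} \<noteq> {}" unfolding F_def by (metis sum.empty)
      then show "c \<in> (\<lambda>i. w i ^ M) ` B" by auto
    qed
    then have "card {c :: complex. c ^ p = 1} \<le> card B"
      using B by (meson surj_card_le)
    then show ?thesis using Complex.card_roots_unity_eq[OF p0] by simp
  qed
  ultimately show ?thesis by blast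
qed

lemma finite_roots_of_unity_common_exponent:
  fixes f :: "'a \<Rightarrow> complex"
  assumes "finite B" "\<And>i. i \<in> B \<Longrightarrow> \<exists>N>0. f i ^ N = 1"
  shows "\<exists>N>0. \<forall>i\<in>B. f i ^ N = 1"
  using assms
proof (induction B rule: finite_induct)
  case (insert x B)
  then obtain N where N: "N > 0" "\<forall>i\<in>B. f i ^ N = 1" by blast
  obtain K where K: "K > 0" "f x ^ K = 1" using insert.prems by blast
  have "f i ^ (N * K) = 1" if "i \<in> insert x B" for i
    using that N K by (auto simp: power_mult) (metis mult.commute power_mult power_one)
  then show ?case using N K by (intro exI[of _ "N * K"]) auto
qed auto

lemma dvd_prod_primes:
  fixes N :: nat
  assumes "finite P" "N > 0" and N: "\<And>p. prime p \<Longrightarrow> p dvd N \<Longrightarrow> p \<in> P \<and> \<not> p ^ 2 dvd N"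
    and P: "\<And>p. p \<in> P \<Longrightarrow> p > 0"
  shows "N dvd \<Prod>P"
proof (rule multiplicity_le_imp_dvd)
  fix p :: nat assume p: "prime p"
  have nz: "\<Prod>P \<noteq> 0" using assms by (metis less_irrefl prod_zero_iff)
  show "multiplicity p N \<le> multiplicity p (\<Prod>P)"
  proof (cases "p dvd N")
    case True
    then have "p dvd \<Prod>P" using N p assms(1) by (intro dvd_prod_eqI) auto
    then have "multiplicity p (\<Prod>P) > 0"
      using nz p by (simp add: prime_multiplicity_gt_zero_iff)
    moreover have "multiplicity p N < 2"
      using N[OF p True] p assms(2) by (intro multiplicity_lessI) auto
    ultimately show ?thesis by simp
  qed (simp add: not_dvd_imp_multiplicity_0)
qed (use assms in simp)

text \<open>Let N be the least common exponent of the ratios to \<open>f j\<close>. For a prime p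
  dividing N some ratio has (N / p)-th power other than 1, which forces p \<le> card B and p not
  dividing N / p. Hence N is squarefree and divides the product.\<close>

theorem mann_minimal_vanishing_sum:
  fixes f :: "'a \<Rightarrow> complex"
  assumes B: "finite B" and sum0: "sum f B = 0"
    and min: "\<And>A. A \<subset> B \<Longrightarrow> A \<noteq> {} \<Longrightarrow> sum f A \<noteq> 0"
    and unity: "\<And>i. i \<in> B \<Longrightarrow> \<exists>N>0. f i ^ N = 1"
    and ij: "i \<in> B" "j \<in> B"
  shows "(f i / f j) ^ \<Prod>{p. prime p \<and> p \<le> card B} = 1"
proof -
  define w where "w k = f k / f j" for k
  have fj: "f j \<noteq> 0" using unity[OF ij(2)] by (auto simp: zero_power)
  have sum_w: "sum w A = sum f A / f j" for A by (simp add: w_def sum_divide_distrib)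
  have sum_w0: "sum w B = 0" using sum0 by (simp add: sum_w)
  have min_w: "sum w A \<noteq> 0" if "A \<subset> B" "A \<noteq> {}" for A using min[OF that] fj by (simp add: sum_w)
  have wj: "w j = 1" using fj by (simp add: w_def)
  define Q where "Q N \<longleftrightarrow> N > 0 \<and> (\<forall>k\<in>B. w k ^ N = 1)" for N :: nat
  obtain N0 where "N0 > 0" "\<forall>k\<in>B. f k ^ N0 = 1"
    using finite_roots_of_unity_common_exponent[of B f] B unity by metis
  then have "Q N0" using ij by (simp add: Q_def w_def power_divide)
  define N where "N = (LEAST N. Q N)"
  have N: "Q N" using \<open>Q N0\<close> unfolding N_def by (rule LeastI)
  then have N': "N > 0" "\<And>k. k \<in> B \<Longrightarrow> w k ^ N = 1" by (auto simp: Q_def)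
  have "p \<in> {p. prime p \<and> p \<le> card B} \<and> \<not> p ^ 2 dvd N" if p: "prime p" "p dvd N" for p
  proof -
    obtain M where M: "N = p * M" using p by blast
    have "M > 0" "M < N" using M N'(1) prime_gt_1_nat[OF p(1)] by (auto intro!: gr0I)
    then have "\<not> Q M" unfolding N_def by (blast dest: not_less_Least)
    then obtain k where "k \<in> B" "w k ^ M \<noteq> 1" using \<open>M > 0\<close> by (auto simp: Q_def)
    then have "\<not> p dvd M \<and> p \<le> card B"
      using N'(2) M by (intro minimal_vanishing_sum_prime[OF B _ p(1) \<open>M > 0\<close> sum_w0 min_w ij(2) wj]) auto
    then show ?thesis using p M by (simp add: power2_eq_square prime_gt_0_nat)
  qed
  then have "N dvd \<Prod>{p. prime p \<and> p \<le> card B}"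
    using N'(1) by (intro dvd_prod_primes) (auto simp: prime_gt_0_nat)
  then show ?thesis using N'(2)[OF ij(1)] by (metis dvdE power_mult power_one w_def)
qed

section \<open>The primorial\<close>

lemma prod_primes_dvd:
  fixes x :: nat
  assumes "finite P" "\<And>p. p \<in> P \<Longrightarrow> prime p" "\<And>p. p \<in> P \<Longrightarrow> p dvd x"
  shows "\<Prod>P dvd x"
  using assms
proof (induction P rule: finite_induct)
  case (insert q P)
  have "coprime q (\<Prod>P)"
    using insert by (intro prod_coprime_right primes_coprime) auto
  then show ?case using insert by (simp add: divides_mult)
qed auto

text \<open>The two middle entries of row 2 m + 1 are equal, and together they are at most the row
  sum 2 * 4 ^ m.\<close>

lemma choose_odd_le: "(2 * m + 1) choose m \<le> 4 ^ m"
proof -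
  have "2 * ((2 * m + 1) choose m) = (\<Sum>k\<in>{m, m + 1}. (2 * m + 1) choose k)"
    using binomial_symmetric[of m "2 * m + 1"] by simp
  also have "\<dots> \<le> (\<Sum>k\<le>2 * m + 1. (2 * m + 1) choose k)"
    by (intro sum_mono2) auto
  also have "\<dots> = 2 * 4 ^ m" unfolding choose_row_sum by (simp add: power_mult)
  finally show ?thesis by simp
qed

text \<open>Erdos's argument: for n = 2 m + 1 the primes above m + 1 divide a middle binomial
  coefficient, and those up to m + 1 are covered by induction. An even n > 2 adds no prime.\<close>

lemma primorial_le: "\<Prod>{p. prime p \<and> p \<le> n} \<le> (4 :: nat) ^ n"
proof (induction n rule: less_induct)
  case (less n)
  consider "n \<le> 1" | "n = 2" | "n > 2" "even n" | "n > 2" "odd n" by linarith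
  then show ?case
  proof cases
    case 1
    then have "{p :: nat. prime p \<and> p \<le> n} = {}" by (auto dest: prime_gt_1_nat)
    then show ?thesis by (simp only: prod.empty) simp
  next
    case 2
    then have "{p :: nat. prime p \<and> p \<le> n} = {2}" by (auto dest: prime_ge_2_nat)
    then show ?thesis using 2 by simp
  next
    case 3
    then have "\<not> prime n" using prime_odd_nat by blast
    then have "{p. prime p \<and> p \<le> n} = {p. prime p \<and> p \<le> n - 1}"
      using 3 by (auto simp: le_eq_less_or_eq)
    moreover have "\<Prod>{p. prime p \<and> p \<le> n - 1} \<le> (4 :: nat) ^ (n - 1)"
      using 3 by (intro less.IH) auto
    moreover have "(4 :: nat) ^ (n - 1) \<le> 4 ^ n" by (simp add: power_increasing)
    ultimately show ?thesis by (metis order.trans)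
  next
    case 4
    then obtain m where m: "n = 2 * m + 1" "m > 0" by (auto elim: oddE)
    \<comment> \<open>As m + 1 = n - m, these primes divide n! but neither m! nor (n - m)!.\<close>
    let ?Q = "{p. prime p \<and> m + 1 < p \<and> p \<le> n}"
    have "\<Prod>?Q dvd n choose m"
    proof (rule prod_primes_dvd)
      fix p assume p: "p \<in> ?Q"
      have "fact m * fact (n - m) * (n choose m) = fact n"
        using m by (intro binomial_fact_lemma) auto
      moreover have "p dvd fact n" "\<not> p dvd fact m" "\<not> p dvd fact (n - m)"
        using p m by (simp_all add: prime_dvd_fact_iff del: fact_Suc)
      ultimately show "p dvd n choose m"
        using p by (metis (no_types, lifting) mem_Collect_eq prime_dvd_mult_iff)
    qed auto
    moreover have "0 < n choose m" using m by (intro zero_less_binomial) linarith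
    ultimately have "\<Prod>?Q \<le> n choose m" by (rule dvd_imp_le)
    also have "\<dots> \<le> 4 ^ m" unfolding m(1) by (rule choose_odd_le)
    finally have Q: "\<Prod>?Q \<le> 4 ^ m" .
    have P: "\<Prod>{p. prime p \<and> p \<le> m + 1} \<le> (4 :: nat) ^ (m + 1)"
      using m by (intro less.IH) auto
    have "{p. prime p \<and> p \<le> n} = {p. prime p \<and> p \<le> m + 1} \<union> ?Q"
      using m by auto
    then have "\<Prod>{p. prime p \<and> p \<le> n} = \<Prod>{p. prime p \<and> p \<le> m + 1} * \<Prod>?Q"
      by (simp only:) (rule prod.union_disjoint, auto)
    also have "\<dots> \<le> 4 ^ (m + 1) * 4 ^ m" using P Q by (rule mult_le_mono)
    also have "\<dots> = 4 ^ n" unfolding m(1) by (simp only: power_add[symmetric]) (simp add: mult_2)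
    finally show ?thesis .
  qed
qed

section \<open>Counting irredundant walks\<close>

definition roots_of_unity :: "complex set" where
  "roots_of_unity = {z. \<exists>N>0. z ^ N = 1}"

lemma minus_roots_of_unity:
  assumes "z \<in> roots_of_unity"
  shows "- z \<in> roots_of_unity"
proof -
  obtain N where N: "N > 0" "z ^ N = 1" using assms by (auto simp: roots_of_unity_def)
  have "(- z) ^ (2 * N) = (z ^ N) ^ 2" by (simp add: power_mult power_even_eq flip: power_mult)
  then show ?thesis using N unfolding roots_of_unity_def by (intro CollectI exI[of _ "2 * N"]) simp
qed

text \<open>Subsums are indexed by positions, so repeated steps count separately. One-element index
  sets already make every step nonzero.\<close>

definition irredundant :: "complex list \<Rightarrow> bool" where
  "irredundant zs \<longleftrightarrow> (\<forall>I \<subseteq> {..<length zs}. I \<noteq> {} \<longrightarrow> (\<Sum>i\<in>I. zs ! i) \<noteq> 0)"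

text \<open>A walk from \<open>v\<close> is stored as its list of steps, the roots of unity to which
  Mann's theorem will apply; its endpoint is \<open>v + sum_list zs\<close>.\<close>

fun walks :: "complex set \<Rightarrow> complex \<Rightarrow> nat \<Rightarrow> complex list set" where
  "walks S v 0 = {[]}"
| "walks S v (Suc k) = (\<lambda>(zs, z). zs @ [z]) `
    (SIGMA zs:walks S v k.
      {z \<in> (\<lambda>q. q - (v + sum_list zs)) ` S. z \<in> roots_of_unity \<and> irredundant (zs @ [z])})"

lemma finite_walks: "finite S \<Longrightarrow> finite (walks S v k)"
  by (induction k) auto

lemma walksD:
  assumes "zs \<in> walks S v k" "v \<in> S"
  shows "length zs = k" "set zs \<subseteq> roots_of_unity" "irredundant zs" "v + sum_list zs \<in> S"
proof -
  have "length zs = k \<and> set zs \<subseteq> roots_of_unity \<and> irredundant zs \<and> v + sum_list zs \<in> S"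
    using assms(1)
  proof (induction k arbitrary: zs)
    case 0
    then show ?case using assms(2) by (auto simp: irredundant_def)
  next
    case (Suc k)
    then show ?case by (fastforce simp: add.assoc)
  qed
  then show "length zs = k" "set zs \<subseteq> roots_of_unity" "irredundant zs" "v + sum_list zs \<in> S"
    by auto
qed

text \<open>A new step can spoil irredundance only if it is the negative of a subset sum of the
  earlier steps, which rules out at most 2 ^ k values.\<close>

lemma card_walks_Suc:
  assumes S: "finite S" "v \<in> S" and deg: "\<And>p. p \<in> S \<Longrightarrow> d \<le> card {q \<in> S. q - p \<in> roots_of_unity}"
  shows "card (walks S v k) * (d - 2 ^ k) \<le> card (walks S v (Suc k))"
proof -
  define N where "N zs = {z \<in> (\<lambda>q. q - (v + sum_list zs)) ` S.
    z \<in> roots_of_unity \<and> irredundant (zs @ [z])}" for zs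
  have "d - 2 ^ k \<le> card (N zs)" if zs: "zs \<in> walks S v k" for zs
  proof -
    define p where "p = v + sum_list zs"
    define X where "X = (\<lambda>q. q - p) ` {q \<in> S. q - p \<in> roots_of_unity}"
    define Y where "Y = (\<lambda>I. - (\<Sum>i\<in>I. zs ! i)) ` Pow {..<k}"
    note zsD = walksD[OF zs S(2)]
    have "p \<in> S" using zsD by (simp add: p_def)
    then have "d \<le> card X"
      unfolding X_def using deg by (subst card_image) (auto intro: inj_onI)
    moreover have "card Y \<le> 2 ^ k"
      unfolding Y_def using card_image_le[of "Pow {..<k}"] by (simp add: card_Pow)
    moreover have "card X - card Y \<le> card (X - Y)"
      by (rule diff_card_le_card_Diff) (simp add: Y_def)
    moreover have "X - Y \<subseteq> N zs"
    proof
      fix z assume z: "z \<in> X - Y"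
      have "irredundant (zs @ [z])"
        unfolding irredundant_def
      proof (intro allI impI)
        fix I assume I: "I \<subseteq> {..<length (zs @ [z])}" "I \<noteq> {}"
        let ?J = "I - {k}"
        have J: "?J \<subseteq> {..<k}" using I zsD(1) by auto
        have sumJ: "(\<Sum>i\<in>?J. (zs @ [z]) ! i) = (\<Sum>i\<in>?J. zs ! i)"
          using J zsD(1) by (intro sum.cong) (auto simp: nth_append)
        \<comment> \<open>Only index sets containing the new position \<open>k\<close> depend on
          \<open>z\<close>; the others are covered by irredundance of \<open>zs\<close>.\<close>
        show "(\<Sum>i\<in>I. (zs @ [z]) ! i) \<noteq> 0"
        proof (cases "k \<in> I")
          case True
          have "finite I" using I finite_subset by blast
          then have "(\<Sum>i\<in>I. (zs @ [z]) ! i) = z + (\<Sum>i\<in>?J. zs ! i)"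
            using True zsD(1) sumJ by (simp add: sum.remove nth_append)
          moreover have "z \<noteq> - (\<Sum>i\<in>?J. zs ! i)" using z J unfolding Y_def by blast
          ultimately show ?thesis by (simp add: add_eq_0_iff2)
        next
          case False
          then have "?J = I" by auto
          then show ?thesis using sumJ J I(2) zsD(1,3) unfolding irredundant_def by metis
        qed
      qed
      then show "z \<in> N zs" using z by (auto simp: N_def X_def p_def)
    qed
    then have "card (X - Y) \<le> card (N zs)"
      using S by (intro card_mono) (auto simp: N_def)
    ultimately show ?thesis by linarith
  qed
  then have "(\<Sum>zs\<in>walks S v k. d - 2 ^ k) \<le> (\<Sum>zs\<in>walks S v k. card (N zs))"
    by (intro sum_mono)
  also have "\<dots> = card (SIGMA zs:walks S v k. N zs)"
    using S by (subst card_SigmaI) (auto simp: finite_walks N_def)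
  also have "\<dots> = card (walks S v (Suc k))"
    by (auto simp: N_def intro!: card_image[symmetric] inj_onI)
  finally show ?thesis by simp
qed

text \<open>The loss 2 ^ j at step j is replaced by the uniform 2 ^ k throughout the
  induction.\<close>

lemma card_walks_ge:
  assumes "finite S" "v \<in> S" and "\<And>p. p \<in> S \<Longrightarrow> d \<le> card {q \<in> S. q - p \<in> roots_of_unity}"
  shows "(d - 2 ^ k) ^ k \<le> card (walks S v k)"
proof -
  have "(d - 2 ^ k) ^ j \<le> card (walks S v j)" if "j \<le> k" for j
    using that
  proof (induction j)
    case (Suc j)
    have "d - 2 ^ k \<le> d - 2 ^ j" using Suc by (intro diff_le_mono2 power_increasing) auto
    then have "(d - 2 ^ k) ^ Suc j \<le> card (walks S v j) * (d - 2 ^ j)"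
      using Suc mult_le_mono[of "(d - 2 ^ k) ^ j" "card (walks S v j)" "d - 2 ^ k" "d - 2 ^ j"]
      by (simp add: mult.commute)
    also have "\<dots> \<le> card (walks S v (Suc j))" using card_walks_Suc assms by blast
    finally show ?case .
  qed simp
  then show ?thesis by simp
qed

section \<open>Walks with a common endpoint\<close>

text \<open>If a proper nonempty part sums to zero, so does its complement, and the descent
  continues in whichever of the two contains \<open>x\<close>.\<close>

lemma minimal_vanishing_subset:
  fixes f :: "'a \<Rightarrow> complex"
  assumes "finite B" "sum f B = 0" "x \<in> B"
  shows "\<exists>C\<subseteq>B. x \<in> C \<and> sum f C = 0 \<and> (\<forall>A. A \<subset> C \<longrightarrow> A \<noteq> {} \<longrightarrow> sum f A \<noteq> 0)"
  using assms
proof (induction B rule: finite_psubset_induct)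
  case (psubset B)
  show ?case
  proof (cases "\<exists>A. A \<subset> B \<and> A \<noteq> {} \<and> sum f A = 0")
    case True
    then obtain A where A: "A \<subset> B" "A \<noteq> {}" "sum f A = 0" by blast
    define A' where "A' = (if x \<in> A then A else B - A)"
    have "sum f (B - A) = 0"
      using A psubset by (simp add: sum_diff psubset_imp_subset)
    then have "A' \<subset> B" "sum f A' = 0" "x \<in> A'" using A psubset.prems by (auto simp: A'_def)
    then show ?thesis using psubset.IH by (meson order.trans psubset_imp_subset)
  qed (use psubset.prems in blast)
qed

text \<open>The steps of \<open>ys\<close> and the negated steps of \<open>zs\<close> form a
  vanishing sum. A minimal vanishing subsum through \<open>- (zs ! j)\<close> cannot lie inside
  \<open>zs\<close>, which is irredundant, so it contains some \<open>ys ! i\<close>, and Mann's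
  theorem bounds the order of the ratio.\<close>

lemma irredundant_step_ratio:
  assumes ys: "irredundant ys" "set ys \<subseteq> roots_of_unity" "length ys = k"
    and zs: "irredundant zs" "set zs \<subseteq> roots_of_unity" "length zs = k"
    and eq: "sum_list ys = sum_list zs" and j: "j < k"
  shows "\<exists>i<k. (- (zs ! j) / ys ! i) ^ \<Prod>{p. prime p \<and> p \<le> 2 * k} = 1"
proof -
  \<comment> \<open>The disjoint sum keeps the two walks apart even where their steps
    coincide.\<close>
  define f :: "nat + nat \<Rightarrow> complex" where "f = case_sum (\<lambda>i. ys ! i) (\<lambda>i. - (zs ! i))"
  define B where "B = {..<k} <+> {..<k}"
  have "sum f B = sum_list ys - sum_list zs"
    using ys(3) zs(3)
    by (simp add: B_def f_def sum.Plus sum_list_sum_nth sum_negf atLeast0LessThan)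
  then have "sum f B = 0" using eq by simp
  then obtain C where C: "C \<subseteq> B" "Inr j \<in> C" "sum f C = 0"
    "\<And>A. A \<subset> C \<Longrightarrow> A \<noteq> {} \<Longrightarrow> sum f A \<noteq> 0"
    using minimal_vanishing_subset[of B f "Inr j"] j by (auto simp: B_def)
  have finC: "finite C" using C(1) by (rule finite_subset) (simp add: B_def)
  have "\<exists>i. Inl i \<in> C"
  proof (rule ccontr)
    assume neg: "\<nexists>i. Inl i \<in> C"
    define I where "I = {i. Inr i \<in> C}"
    have CI: "C = Inr ` I"
    proof
      show "C \<subseteq> Inr ` I"
      proof
        fix x assume "x \<in> C"
        then show "x \<in> Inr ` I" using neg by (cases x) (auto simp: I_def)
      qed
    qed (auto simp: I_def)
    have "(\<Sum>i\<in>I. - (zs ! i)) = sum f C"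
      unfolding CI by (subst sum.reindex) (auto simp: f_def)
    then have "(\<Sum>i\<in>I. zs ! i) = 0" using C(3) by (simp add: sum_negf)
    moreover have "I \<subseteq> {..<length zs}" "I \<noteq> {}" using C(1,2) zs(3) by (auto simp: I_def B_def)
    ultimately show False using zs(1) unfolding irredundant_def by blast
  qed
  then obtain i where i: "Inl i \<in> C" by blast
  have unity: "\<exists>N>0. f x ^ N = 1" if "x \<in> C" for x
  proof (cases x)
    case (Inl a)
    then have "ys ! a \<in> set ys" using that C(1) ys(3) by (auto simp: B_def)
    then have "ys ! a \<in> roots_of_unity" using ys(2) by blast
    then show ?thesis using Inl by (simp add: f_def roots_of_unity_def)
  next
    case (Inr a)
    then have "zs ! a \<in> set zs" using that C(1) zs(3) by (auto simp: B_def)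
    then have "zs ! a \<in> roots_of_unity" using zs(2) by blast
    then have "- (zs ! a) \<in> roots_of_unity" by (rule minus_roots_of_unity)
    then show ?thesis using Inr by (simp add: f_def roots_of_unity_def)
  qed
  have mann: "(f (Inr j) / f (Inl i)) ^ \<Prod>{p. prime p \<and> p \<le> card C} = 1"
    using mann_minimal_vanishing_sum[OF finC C(3,4) unity C(2) i] by simp
  have "card C \<le> card B" using C(1) by (intro card_mono) (auto simp: B_def)
  then have "card C \<le> 2 * k" by (simp add: B_def card_Plus)
  \<comment> \<open>Passing to primes up to 2 k gives one exponent for all minimal subsums.\<close>
  then have "\<Prod>{p. prime p \<and> p \<le> card C} dvd \<Prod>{p. prime p \<and> p \<le> 2 * k}"
    by (intro prod_dvd_prod_subset) auto
  then obtain c where c: "\<Prod>{p. prime p \<and> p \<le> 2 * k} = \<Prod>{p. prime p \<and> p \<le> card C} * c" ..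
  have "(f (Inr j) / f (Inl i)) ^ \<Prod>{p. prime p \<and> p \<le> 2 * k} = 1"
    unfolding c by (simp only: power_mult mann power_one)
  moreover have "i < k" using i C(1) by (auto simp: B_def)
  ultimately show ?thesis by (auto simp: f_def)
qed

text \<open>Relative to one fixed walk \<open>ys\<close>, each step of a walk with the same endpoint
  is determined by an index \<open>i\<close> and an m-th root of unity, where m \<le> 4 ^ (2 k) = 16
  ^ k. This leaves at most k * 16 ^ k choices per step.\<close>

lemma card_walks_endpoint_le:
  assumes "finite S" "v \<in> S"
  shows "card {zs \<in> walks S v k. v + sum_list zs = w} \<le> (k * 16 ^ k) ^ k"
proof (cases "{zs \<in> walks S v k. v + sum_list zs = w} = {}")
  case False
  then obtain ys where ys: "ys \<in> walks S v k" "v + sum_list ys = w" by blast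
  define m where "m = \<Prod>{p::nat. prime p \<and> p \<le> 2 * k}"
  have "m > 0" unfolding m_def by (intro prod_pos) (auto simp: prime_gt_0_nat)
  define R where "R = {x::complex. x ^ m = 1}"
  have R: "finite R" "card R = m"
    using Complex.card_roots_unity_eq[OF \<open>m > 0\<close>] \<open>m > 0\<close>
    by (auto simp: R_def intro: card_ge_0_finite)
  define T where "T = (\<lambda>(i, x). - (ys ! i * x)) ` ({..<k} \<times> R)"
  have "finite T" using R by (simp add: T_def)
  have "m \<le> 4 ^ (2 * k)" unfolding m_def by (rule primorial_le)
  also have "(4 :: nat) ^ (2 * k) = 16 ^ k" by (simp add: power_mult)
  finally have "card T \<le> k * 16 ^ k"
    unfolding T_def using card_image_le[of "{..<k} \<times> R" "\<lambda>(i, x). - (ys ! i * x)"] R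
    by (simp add: card_cartesian_product) (meson mult_le_mono2 order.trans)
  note ysD = walksD[OF ys(1) assms(2)]
  have "{zs \<in> walks S v k. v + sum_list zs = w} \<subseteq> {zs. set zs \<subseteq> T \<and> length zs = k}"
  proof safe
    fix zs z assume zs: "zs \<in> walks S v k" "w = v + sum_list zs" and "z \<in> set zs"
    note zsD = walksD[OF zs(1) assms(2)]
    obtain j where j: "j < k" "z = zs ! j" using \<open>z \<in> set zs\<close> zsD(1) by (metis in_set_conv_nth)
    have "sum_list ys = sum_list zs" using ys zs by simp
    then obtain i where i: "i < k" "(- (zs ! j) / ys ! i) ^ m = 1"
      using irredundant_step_ratio[OF ysD(3,2,1) zsD(3,2,1) _ j(1)] by (auto simp: m_def)
    have "ys ! i \<noteq> 0" using i ysD \<open>m > 0\<close> by (auto simp: zero_power)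
    then have "z = - (ys ! i * (- (zs ! j) / ys ! i))" using j by simp
    then show "z \<in> T" using i unfolding T_def R_def by (auto intro!: image_eqI[of _ _ "(i, - (zs ! j) / ys ! i)"])
  qed (use walksD assms in auto)
  then have "card {zs \<in> walks S v k. v + sum_list zs = w} \<le> card {zs. set zs \<subseteq> T \<and> length zs = k}"
    using \<open>finite T\<close> by (intro card_mono finite_lists_length_eq)
  also have "\<dots> = card T ^ k" by (rule card_lists_length_eq[OF \<open>finite T\<close>])
  also have "\<dots> \<le> (k * 16 ^ k) ^ k" using \<open>card T \<le> k * 16 ^ k\<close> by (rule power_mono) simp
  finally show ?thesis .
next
  case True
  then show ?thesis by (simp only: card.empty)
qed

lemma card_walks_le:
  assumes "finite S" "v \<in> S"
  shows "card (walks S v k) \<le> card S * (k * 16 ^ k) ^ k"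
proof -
  have "walks S v k = (\<Union>w\<in>S. {zs \<in> walks S v k. v + sum_list zs = w})"
    using walksD(4)[OF _ assms(2)] by blast
  then have "card (walks S v k) \<le> (\<Sum>w\<in>S. card {zs \<in> walks S v k. v + sum_list zs = w})"
    using card_UN_le[OF assms(1), of "\<lambda>w. {zs \<in> walks S v k. v + sum_list zs = w}"] by simp
  also have "\<dots> \<le> (\<Sum>w\<in>S. (k * 16 ^ k) ^ k)"
    using assms by (intro sum_mono card_walks_endpoint_le)
  finally show ?thesis by simp
qed

section \<open>Passing to a subset of large minimum degree\<close>

text \<open>Points of degree below \<open>d\<close> are deleted one by one; the density condition on
  ordered pairs survives each deletion.\<close>

lemma min_degree_subset:
  assumes "finite S" "S \<noteq> {}" "d > 0" and sym: "\<And>p q. R p q \<Longrightarrow> R q p"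
    and "2 * d * card S \<le> card {(p, q) \<in> S \<times> S. R p q}"
  shows "\<exists>T\<subseteq>S. T \<noteq> {} \<and> (\<forall>p\<in>T. d \<le> card {q \<in> T. R p q})"
  using assms(1,2,5)
proof (induction S rule: finite_psubset_induct)
  case (psubset S)
  show ?case
  proof (cases "\<forall>p\<in>S. d \<le> card {q \<in> S. R p q}")
    case False
    then obtain p where p: "p \<in> S" "card {q \<in> S. R p q} < d" by force
    define E where "E X = {(p, q) \<in> X \<times> X. R p q}" for X
    let ?N = "{q \<in> S. R p q}" and ?S = "S - {p}"
    have fin: "finite (E ?S)" "finite ?N"
      using psubset(1) by (auto simp: E_def intro: finite_subset[of _ "S \<times> S"])
    have "E S \<subseteq> E ?S \<union> ({p} \<times> ?N \<union> ?N \<times> {p})" using sym by (auto simp: E_def)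
    then have "card (E S) \<le> card (E ?S \<union> ({p} \<times> ?N \<union> ?N \<times> {p}))"
      using fin by (intro card_mono) auto
    also have "\<dots> \<le> card (E ?S) + (card ({p} \<times> ?N) + card (?N \<times> {p}))"
      by (meson add_left_mono card_Un_le order.trans)
    finally have "card (E S) \<le> card (E ?S) + 2 * card ?N" by (simp add: card_cartesian_product)
    moreover have "card S = Suc (card ?S)" using p psubset(1) by (metis card.remove)
    \<comment> \<open>Fewer than 2 d ordered pairs disappear with \<open>p\<close>, so the
      inequality becomes strict. Pairs therefore remain, and the smaller set is nonempty.\<close>
    ultimately have "2 * d * card ?S < card (E ?S)"
      using psubset.prems(2) p(2) by (simp add: E_def)
    moreover from this have "E ?S \<noteq> {}" by force
    then have "?S \<noteq> {}" unfolding E_def by blast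
    ultimately have "?S \<noteq> {}" "2 * d * card ?S \<le> card (E ?S)" by auto
    then obtain T where "T \<subseteq> ?S" "T \<noteq> {}" "\<forall>p\<in>T. d \<le> card {q \<in> T. R p q}"
      using psubset.IH[of ?S] p by (auto simp: E_def)
    then show ?thesis by (intro exI[of _ T]) auto
  qed (use psubset.prems in blast)
qed

lemma few_unity_differences:
  assumes "finite S" "S \<noteq> {}" "d > 0"
    and "2 * d * card S \<le> card {(p, q) \<in> S \<times> S. q - p \<in> roots_of_unity}"
  shows "(d - 2 ^ k) ^ k \<le> card S * (k * 16 ^ k) ^ k"
proof -
  have "q - p \<in> roots_of_unity \<Longrightarrow> p - q \<in> roots_of_unity" for p q
    using minus_roots_of_unity[of "q - p"] by simp
  then obtain T where T: "T \<subseteq> S" "T \<noteq> {}"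
    and deg: "\<And>p. p \<in> T \<Longrightarrow> d \<le> card {q \<in> T. q - p \<in> roots_of_unity}"
    using min_degree_subset[of S d "\<lambda>p q. q - p \<in> roots_of_unity"] assms by blast
  obtain v where v: "v \<in> T" using T by blast
  have fT: "finite T" using T(1) assms(1) by (rule finite_subset)
  have "(d - 2 ^ k) ^ k \<le> card (walks T v k)" using card_walks_ge fT v deg by blast
  also have "\<dots> \<le> card T * (k * 16 ^ k) ^ k" using fT v by (rule card_walks_le)
  also have "\<dots> \<le> card S * (k * 16 ^ k) ^ k"
    using T(1) assms(1) by (intro mult_le_mono1 card_mono)
  finally show ?thesis .
qed

section \<open>Unit distances with rational angles\<close>

lemma exp_rational_angle_in_roots_of_unity:
  assumes "\<gamma> \<in> \<rat>"
  shows "exp (complex_of_real (pi * \<gamma>) * \<i>) \<in> roots_of_unity"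
proof -
  obtain a b :: int where ab: "b > 0" "\<gamma> = of_int a / of_int b"
    using assms by (rule Rats_cases')
  have "exp (complex_of_real (pi * \<gamma>) * \<i>) = cis (pi * \<gamma>)"
    by (simp add: cis_conv_exp mult.commute)
  also have "\<dots> ^ (2 * nat b) = cis (real (2 * nat b) * (pi * \<gamma>))"
    by (rule Complex.DeMoivre)
  also have "real (2 * nat b) * (pi * \<gamma>) = 2 * pi * of_int a" using ab by simp
  also have "cis (2 * pi * of_int a) = 1" by (simp add: cis_multiple_2pi)
  finally show ?thesis using ab unfolding roots_of_unity_def
    by (intro CollectI exI[of _ "2 * nat b"]) simp
qed

lemma unit_rational_angle_in_roots_of_unity:
  assumes "cmod (p - q) = 1" "rational_angle p q"
  shows "q - p \<in> roots_of_unity"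
proof -
  obtain r \<gamma> :: real where r: "r > 0" "\<gamma> \<in> \<rat>"
    and eq: "q - p = complex_of_real r * exp (complex_of_real (pi * \<gamma>) * \<i>)"
    using assms(2) unfolding rational_angle_def by blast
  have "cmod (q - p) = r" using r(1) unfolding eq by (simp add: norm_mult)
  then have "r = 1" using assms(1) by (simp add: norm_minus_commute)
  then show ?thesis using eq exp_rational_angle_in_roots_of_unity[OF r(2)] by simp
qed

text \<open>Each unordered pair comes from ordered ones; the factor two between the counts is given
  away.\<close>

lemma card_unit_rational_pairs_le:
  assumes "finite S"
  shows "card (unit_rational_pairs S) \<le> card {(p, q) \<in> S \<times> S. q - p \<in> roots_of_unity}"
proof -
  let ?E = "{(p, q) \<in> S \<times> S. q - p \<in> roots_of_unity}"
  have fin: "finite ?E" using assms by (auto intro: finite_subset[of _ "S \<times> S"])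
  have "unit_rational_pairs S \<subseteq> (\<lambda>(p, q). {p, q}) ` ?E"
    unfolding unit_rational_pairs_def
    by (fastforce dest: unit_rational_angle_in_roots_of_unity)
  then show ?thesis using fin by (meson card_image_le card_mono finite_imageI order.trans)
qed

section \<open>Choice of parameters and the final estimate\<close>

text \<open>Each of the three summands on the left is at most exp (5 s), and exp s > 7 > 6 absorbs
  both the factor 3 and the division by 2.\<close>

lemma degree_threshold:
  fixes s :: real
  assumes s: "s > 6" and k: "s / 2 \<le> real k" "real k < s / 2 + 1"
  shows "exp (2 * s) * real (k * 16 ^ k) + 2 ^ k + 1 < exp (6 * s) / 2"
proof -
  have "real k \<le> exp s" using exp_ge_add_one_self[of s] k s by linarith
  have e1: "(2 :: real) \<le> exp 1" using exp_ge_add_one_self[of 1] by simp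
  \<comment> \<open>The exponent 24 is large enough for (1 + 3 / 24) ^ 24 = (9 / 8) ^ 24 to exceed
    16.\<close>
  have "(16 :: real) \<le> (1 + 3 / of_nat 24) ^ 24" by (simp add: power_divide)
  also have "\<dots> \<le> exp 3" by (rule exp_ge_one_plus_x_over_n_power_n) simp_all
  finally have "(16 :: real) \<le> exp 3" .
  then have "(16 :: real) ^ k \<le> exp 3 ^ k" by (rule power_mono) simp
  also have "\<dots> = exp (3 * real k)" by (simp add: exp_of_nat_mult[symmetric] mult.commute)
  \<comment> \<open>Here 3 k < 3 s / 2 + 3, which is below 2 s exactly because s > 6.\<close>
  also have "\<dots> \<le> exp (2 * s)" using k s by simp
  finally have "real (k * 16 ^ k) \<le> exp s * exp (2 * s)"
    using \<open>real k \<le> exp s\<close> by (simp add: mult_mono)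
  then have "exp (2 * s) * real (k * 16 ^ k) \<le> exp (2 * s) * (exp s * exp (2 * s))"
    by (intro mult_left_mono) auto
  also have "\<dots> = exp (5 * s)" by (simp flip: exp_add)
  finally have 1: "exp (2 * s) * real (k * 16 ^ k) \<le> exp (5 * s)" .
  have "(2 :: real) ^ k \<le> exp 1 ^ k" using e1 by (rule power_mono) simp
  also have "\<dots> = exp (real k)" by (simp add: exp_of_nat_mult[symmetric])
  also have "\<dots> \<le> exp (5 * s)" using k s by simp
  finally have 2: "(2 :: real) ^ k \<le> exp (5 * s)" .
  have "7 < exp s" using exp_ge_add_one_self[of s] s by linarith
  then have "7 * exp (5 * s) < exp s * exp (5 * s)" by simp
  also have "\<dots> = exp (6 * s)" by (simp flip: exp_add)
  finally have "7 * exp (5 * s) < exp (6 * s)" .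
  moreover have "1 < exp (5 * s)" using s by simp
  ultimately show ?thesis using 1 2 by linarith
qed

theorem theorem1:
  fixes S :: "complex set" and n :: nat
  assumes "finite S" and "card S = n" and "n \<ge> 2"
  shows "real (card (unit_rational_pairs S)) \<le> real n powr (1 + 6 / sqrt (ln (real n)))"
proof -
  define s where "s = sqrt (ln (real n))"
  define E where "E = {(p, q) \<in> S \<times> S. q - p \<in> roots_of_unity}"
  have "ln (real n) > 0" using assms(3) by simp
  then have s0: "s > 0" and s2: "s\<^sup>2 = ln (real n)" by (simp_all add: s_def)
  have n_exp: "real n = exp (s\<^sup>2)" using assms(3) by (simp add: s2)
  have "real n powr (1 + 6 / s) = exp ((1 + 6 / s) * s\<^sup>2)"
    using assms(3) by (simp add: powr_def s2)
  also have "(1 + 6 / s) * s\<^sup>2 = s\<^sup>2 + 6 * s" using s0 by (simp add: field_simps power2_eq_square)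
  finally have bound: "real n powr (1 + 6 / s) = real n * exp (6 * s)"
    by (simp add: exp_add n_exp)
  have "real (card E) \<le> real n * exp (6 * s)"
  proof (rule ccontr)
    assume neg: "\<not> ?thesis"
    \<comment> \<open>The trivial bound n ^ 2 = n exp (s ^ 2) already suffices when s \<le> 6, so a
      counterexample has s > 6.\<close>
    have "card E \<le> card (S \<times> S)" using assms(1) by (intro card_mono) (auto simp: E_def)
    then have "card E \<le> n * n" using assms(2) by (simp add: card_cartesian_product)
    then have "real (card E) \<le> real n * exp (s\<^sup>2)"
      unfolding n_exp[symmetric] by (metis of_nat_le_iff of_nat_mult)
    then have "real n * exp (6 * s) < real n * exp (s\<^sup>2)" using neg by linarith
    then have "6 * s < s\<^sup>2" using assms(3) by simp
    then have s6: "s > 6" using s0 by (simp add: power2_eq_square)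
    \<comment> \<open>Rounding s / 2 up gives s ^ 2 \<le> 2 k s, hence n \<le> exp (2 s) ^ k, while
      16 ^ k stays below exp (2 s).\<close>
    define k where "k = nat \<lceil>s / 2\<rceil>"
    have k: "s / 2 \<le> real k" "real k < s / 2 + 1" using s0 unfolding k_def by linarith+
    \<comment> \<open>The degree is half of exp (6 s) because \<open>few_unity_differences\<close>
      asks for 2 d n ordered pairs; rounding down costs the 1 in
      \<open>degree_threshold\<close>.\<close>
    define d where "d = nat \<lfloor>exp (6 * s) / 2\<rfloor>"
    have d: "real d \<le> exp (6 * s) / 2" "exp (6 * s) / 2 < real d + 1"
      unfolding d_def using exp_gt_zero[of "6 * s"] of_nat_floor[of "exp (6 * s) / 2"]
      by (simp, linarith)
    have thr: "exp (2 * s) * real (k * 16 ^ k) + 2 ^ k < real d"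
      using degree_threshold[OF s6 k] d by linarith
    have "0 \<le> exp (2 * s) * real (k * 16 ^ k)" by simp
    then have "(2 :: real) ^ k < real d" using thr by linarith
    then have "real (2 ^ k) < real d" by (simp only: of_nat_power of_nat_numeral)
    then have "2 ^ k < d" by (simp only: of_nat_less_iff)
    then have d_gt: "exp (2 * s) * real (k * 16 ^ k) < real (d - 2 ^ k)"
      using thr by (simp add: of_nat_diff)
    have "d > 0" using \<open>2 ^ k < d\<close> by (rule gr_implies_not_zero[THEN neq0_conv[THEN iffD1]])
    have "k > 0" using k s0 by (auto intro!: gr0I)
    have "real (2 * d * n) \<le> real n * exp (6 * s)"
      using mult_left_mono[OF d(1), of "2 * real n"] by (simp add: mult_ac)
    then have "real (2 * d * n) \<le> real (card E)" using neg by linarith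
    then have "2 * d * card S \<le> card E" using assms(2) by (simp only: of_nat_le_iff)
    then have "(d - 2 ^ k) ^ k \<le> n * (k * 16 ^ k) ^ k"
      using few_unity_differences[of S d k] assms \<open>d > 0\<close> unfolding E_def by force
    then have "real ((d - 2 ^ k) ^ k) \<le> real (n * (k * 16 ^ k) ^ k)" by (simp only: of_nat_le_iff)
    also have "\<dots> = exp (s\<^sup>2) * real (k * 16 ^ k) ^ k"
      unfolding n_exp[symmetric] by (simp only: of_nat_mult of_nat_power)
    \<comment> \<open>The factor n is spread over the k steps as exp (2 s) each, so that
      \<open>d_gt\<close> can be raised to the k-th power.\<close>
    also have "\<dots> \<le> exp (2 * s) ^ k * real (k * 16 ^ k) ^ k"
    proof (intro mult_right_mono)
      have "s\<^sup>2 \<le> real k * (2 * s)" using mult_right_mono[OF k(1), of "2 * s"] s0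
        by (simp add: power2_eq_square)
      then show "exp (s\<^sup>2) \<le> exp (2 * s) ^ k" by (simp add: exp_of_nat_mult[symmetric])
    qed simp
    also have "\<dots> < real (d - 2 ^ k) ^ k"
      unfolding power_mult_distrib[symmetric]
      using d_gt \<open>k > 0\<close> by (intro power_strict_mono) auto
    finally show False by (simp only: of_nat_power)
  qed
  moreover have "real (card (unit_rational_pairs S)) \<le> real (card E)"
    using card_unit_rational_pairs_le[OF assms(1)] by (simp add: E_def)
  ultimately show ?thesis using bound by (simp add: s_def)
qed

end
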